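(* Suppose we have $\mathbf{x} \in \mathbb{R}^{k}$ and $\mathbf{V} \in \mathbb{R}^{k \times m}$. Define $\mathbf{s} \triangleq \mathrm{softmax}(\mathbf{x})$, $\mathbf{a} \triangleq \mathbf{s}^T\mathbf{V}$, and $\sigma^2_{\mathbf{a}} \triangleq \mathrm{Var}[\mathbf{a}]$. Assume that each element $x_i \overset{\text{iid}}{\sim} \mathcal{N}(0,1)$, and that the entries $V_{ij}$ are independent and distributed with $\mu_{\mathbf{V}} \triangleq \mathrm{E}[\mathbf{V}] = 0$ and $\sigma^2_{\mathbf{V}} \triangleq \mathrm{Var}[\mathbf{V}] = 1$. Then, up to a first-order Taylor approximation, $\sigma^2_{\mathbf{a}} \propto \frac{1}{k}$ for $k \gg 1$.
   Context: The softmax of $\mathbf{x}\in\mathbb{R}^k$ is the vector $\mathbf{s}\in\mathbb{R}^k$ with entries $s_i = \mathrm{softmax}(\mathbf{x})_i = \frac{e^{x_i}}{\sum_{j=1}^{k} e^{x_j}}$. The vector $\mathbf{a}\in\mathbb{R}^m$ has entries $a_j = \sum_{i=1}^k s_i V_{ij}$. For a random vector or matrix, $\mathrm{E}[\cdot]$ and $\mathrm{Var}[\cdot]$ denote the mean and variance of an individual (scalar) entry; thus $\sigma^2_{\mathbf{a}}$ is the variance of an entry of $\mathbf{a}$. "Up to a first-order Taylor approximation" means that the mean and variance of each softmax entry, viewed as the ratio of its numerator $e^{x_i}$ to its denominator $\sum_{j=1}^k e^{x_j}$, are estimated by the standard first-order Taylor approximations for the moments of a ratio of two random variables. "$\sigma^2_{\mathbf{a}}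 \propto \frac1k$ for $k\gg1$" means that the dominant term of the resulting expression for $\sigma^2_{\mathbf{a}}$ for large $k$ is a constant multiple of $1/k$. *)

theory Defs
  imports "HOL-Probability.Probability" "HOL-Library.Landau_Symbols"
begin

text \<open>
  The dimension \<open>k\<close> varies (it tends to infinity), so vectors in \<open>\<real>\<^sup>k\<close> are functions on \<^typ>\<open>nat\<close>
  of which only the entries with index below \<open>k\<close> are used.
\<close>

definition softmax :: "nat \<Rightarrow> (nat \<Rightarrow> real) \<Rightarrow> nat \<Rightarrow> real" where
  "softmax k x i = exp (x i) / (\<Sum>j<k. exp (x j))"

definition vec_mat_mult :: "nat \<Rightarrow> (nat \<Rightarrow> real) \<Rightarrow> (nat \<Rightarrow> nat \<Rightarrow> real) \<Rightarrow> nat \<Rightarrow> real" where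
  "vec_mat_mult k s V j = (\<Sum>i<k. s i * V i j)"

definition taylor1 ::
    "('a::real_normed_vector \<Rightarrow> 'b::real_normed_vector) \<Rightarrow> 'a \<Rightarrow> 'a \<Rightarrow> 'b" where
  "taylor1 f p z = f p + frechet_derivative f (at p) (z - p)"

text \<open>
  The first-order Taylor approximation of the ratio \<open>N / D\<close> of two random variables: the map
  \<open>(n, d) \<mapsto> n / d\<close> is expanded around the pair of means of \<open>N\<close> and \<open>D\<close>.  The approximate moments of
  the ratio are the moments of this linearisation; the lemmas \<open>ratio_mean1_eq\<close> and \<open>ratio_var1_eq\<close>
  below give the usual closed forms.
\<close>

definition ratio1 :: "'a measure \<Rightarrow> ('a \<Rightarrow> real) \<Rightarrow> ('a \<Rightarrow> real) \<Rightarrow> 'a \<Rightarrow> real" where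
  "ratio1 M N D \<omega> =
     taylor1 (\<lambda>p. fst p / snd p) (prob_space.expectation M N, prob_space.expectation M D) (N \<omega>, D \<omega>)"

definition ratio_mean1 :: "'a measure \<Rightarrow> ('a \<Rightarrow> real) \<Rightarrow> ('a \<Rightarrow> real) \<Rightarrow> real" where
  "ratio_mean1 M N D = prob_space.expectation M (ratio1 M N D)"

definition ratio_var1 :: "'a measure \<Rightarrow> ('a \<Rightarrow> real) \<Rightarrow> ('a \<Rightarrow> real) \<Rightarrow> real" where
  "ratio_var1 M N D = prob_space.variance M (ratio1 M N D)"

definition softmax_mean1 :: "'a measure \<Rightarrow> nat \<Rightarrow> (nat \<Rightarrow> 'a \<Rightarrow> real) \<Rightarrow> nat \<Rightarrow> real" where
  "softmax_mean1 M k x i = ratio_mean1 M (\<lambda>\<omega>. exp (x i \<omega>)) (\<lambda>\<omega>. \<Sum>j<k. exp (x j \<omega>))"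

definition softmax_var1 :: "'a measure \<Rightarrow> nat \<Rightarrow> (nat \<Rightarrow> 'a \<Rightarrow> real) \<Rightarrow> nat \<Rightarrow> real" where
  "softmax_var1 M k x i = ratio_var1 M (\<lambda>\<omega>. exp (x i \<omega>)) (\<lambda>\<omega>. \<Sum>j<k. exp (x j \<omega>))"

text \<open>
  The variance of an entry of \<open>s\<^sup>T V\<close> as an expression in the means \<open>\<mu>\<close> and variances \<open>v\<close> of the
  entries of \<open>s\<close>, for independent entries of \<open>V\<close> of mean 0 and variance 1, independent of \<open>s\<close>:
  \<open>Var[s\<^sub>i V\<^sub>i\<^sub>j] = E[s\<^sub>i\<^sup>2] E[V\<^sub>i\<^sub>j\<^sup>2] = v\<^sub>i + \<mu>\<^sub>i\<^sup>2\<close>, and distinct summands are uncorrelated.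
\<close>

definition var_of_moments :: "nat \<Rightarrow> (nat \<Rightarrow> real) \<Rightarrow> (nat \<Rightarrow> real) \<Rightarrow> real" where
  "var_of_moments k \<mu> v = (\<Sum>i<k. v i + (\<mu> i)\<^sup>2)"

lemma ratio1_eq:
  fixes M :: "'a measure" and N D :: "'a \<Rightarrow> real"
  defines "n \<equiv> prob_space.expectation M N" and "d \<equiv> prob_space.expectation M D"
  assumes "d \<noteq> 0"
  shows "ratio1 M N D \<omega> = n / d + (N \<omega> - n) / d - n * (D \<omega> - d) / d\<^sup>2"
proof -
  have "((\<lambda>p. fst p / snd p) has_derivative
      (\<lambda>h. (fst h * snd (n, d) - fst (n, d) * snd h) / (snd (n, d) * snd (n, d)))) (at (n, d))"
    using assms(3)
    by (intro has_derivative_divide' has_derivative_fst has_derivative_snd has_derivative_ident) auto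
  then have "frechet_derivative (\<lambda>p. fst p / snd p) (at (n, d)) =
      (\<lambda>h. (fst h * d - n * snd h) / (d * d))"
    by (simp add: frechet_derivative_at[symmetric])
  then show ?thesis
    using assms(3) unfolding ratio1_def taylor1_def n_def[symmetric] d_def[symmetric]
    by (simp add: diff_divide_distrib power2_eq_square)
qed

lemma ratio_mean1_eq:
  fixes M :: "'a measure" and N D :: "'a \<Rightarrow> real"
  assumes "prob_space M" "integrable M N" "integrable M D" "prob_space.expectation M D \<noteq> 0"
  shows "ratio_mean1 M N D = prob_space.expectation M N / prob_space.expectation M D"
proof -
  interpret prob_space M by fact
  let ?n = "expectation N" and ?d = "expectation D"
  have "ratio1 M N D = (\<lambda>\<omega>. ?n / ?d + (N \<omega> - ?n) / ?d - ?n * (D \<omega> - ?d) / ?d\<^sup>2)"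
    using assms(4) by (intro ext ratio1_eq)
  then show ?thesis
    using assms(2,3) by (simp add: ratio_mean1_def prob_space)
qed

lemma ratio_var1_eq:
  fixes M :: "'a measure" and N D :: "'a \<Rightarrow> real"
  assumes M: "prob_space M"
    and int: "integrable M N" "integrable M D"
      "integrable M (\<lambda>\<omega>. (N \<omega>)\<^sup>2)" "integrable M (\<lambda>\<omega>. (D \<omega>)\<^sup>2)"
  defines "n \<equiv> prob_space.expectation M N" and "d \<equiv> prob_space.expectation M D"
  assumes nz: "n \<noteq> 0" "d \<noteq> 0"
  shows "ratio_var1 M N D = n\<^sup>2 / d\<^sup>2 *
    (prob_space.variance M N / n\<^sup>2
      - 2 * prob_space.expectation M (\<lambda>\<omega>. (N \<omega> - n) * (D \<omega> - d)) / (n * d)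
      + prob_space.variance M D / d\<^sup>2)"
proof -
  interpret prob_space M by fact
  let ?N = "\<lambda>\<omega>. N \<omega> - n" and ?D = "\<lambda>\<omega>. D \<omega> - d"
  have sq: "integrable M (\<lambda>\<omega>. (?N \<omega>)\<^sup>2)" "integrable M (\<lambda>\<omega>. (?D \<omega>)\<^sup>2)"
    using int by (auto simp: power2_diff)
  have ND: "integrable M (\<lambda>\<omega>. ?N \<omega> * ?D \<omega>)"
  proof (rule Bochner_Integration.integrable_bound)
    show "integrable M (\<lambda>\<omega>. (?N \<omega>)\<^sup>2 + (?D \<omega>)\<^sup>2)"
      using sq by simp
    show "(\<lambda>\<omega>. ?N \<omega> * ?D \<omega>) \<in> borel_measurable M"
      using int by measurable
    have "\<bar>a * b\<bar> \<le> a\<^sup>2 + b\<^sup>2" for a b :: real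
    proof -
      have "2 * (\<bar>a\<bar> * \<bar>b\<bar>) \<le> a\<^sup>2 + b\<^sup>2" "0 \<le> \<bar>a\<bar> * \<bar>b\<bar>"
        using sum_squares_bound[of "\<bar>a\<bar>" "\<bar>b\<bar>"] by simp_all
      then show ?thesis
        unfolding abs_mult by linarith
    qed
    then show "AE \<omega> in M. norm (?N \<omega> * ?D \<omega>) \<le> norm ((?N \<omega>)\<^sup>2 + (?D \<omega>)\<^sup>2)"
      by simp
  qed
  have "ratio_var1 M N D = expectation (\<lambda>\<omega>. (ratio1 M N D \<omega> - n / d)\<^sup>2)"
    using ratio_mean1_eq[OF M int(1,2)] nz by (simp add: ratio_var1_def ratio_mean1_def n_def d_def)
  also have "\<dots> = expectation (\<lambda>\<omega>. (1 / d\<^sup>2) * (?N \<omega>)\<^sup>2 - (2 * n / d ^ 3) * (?N \<omega> * ?D \<omega>)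
      + (n\<^sup>2 / d ^ 4) * (?D \<omega>)\<^sup>2)"
  proof (rule Bochner_Integration.integral_cong[OF refl])
    fix \<omega>
    have "ratio1 M N D \<omega> = n / d + ?N \<omega> / d - n * ?D \<omega> / d\<^sup>2"
      using nz(2) unfolding n_def d_def by (rule ratio1_eq)
    then have "(ratio1 M N D \<omega> - n / d)\<^sup>2 = (?N \<omega> / d - n * ?D \<omega> / d\<^sup>2)\<^sup>2"
      by simp
    also have "(p / d - n * q / d\<^sup>2)\<^sup>2 = (1 / d\<^sup>2) * p\<^sup>2 - (2 * n / d ^ 3) * (p * q) + (n\<^sup>2 / d ^ 4) * q\<^sup>2"
      for p q
      using nz(2) by (simp add: field_simps power2_eq_square power3_eq_cube power4_eq_xxxx)
    finally show "(ratio1 M N D \<omega> - n / d)\<^sup>2 = (1 / d\<^sup>2) * (?N \<omega>)\<^sup>2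
        - (2 * n / d ^ 3) * (?N \<omega> * ?D \<omega>) + (n\<^sup>2 / d ^ 4) * (?D \<omega>)\<^sup>2" .
  qed
  also have "\<dots> = (1 / d\<^sup>2) * expectation (\<lambda>\<omega>. (?N \<omega>)\<^sup>2)
      - (2 * n / d ^ 3) * expectation (\<lambda>\<omega>. ?N \<omega> * ?D \<omega>)
      + (n\<^sup>2 / d ^ 4) * expectation (\<lambda>\<omega>. (?D \<omega>)\<^sup>2)"
    using sq ND by (simp del: times_divide_eq_left)
  also have "\<dots> = n\<^sup>2 / d\<^sup>2 * (expectation (\<lambda>\<omega>. (?N \<omega>)\<^sup>2) / n\<^sup>2
      - 2 * expectation (\<lambda>\<omega>. ?N \<omega> * ?D \<omega>) / (n * d) + expectation (\<lambda>\<omega>. (?D \<omega>)\<^sup>2) / d\<^sup>2)"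
    using nz by (simp add: field_simps power2_eq_square power3_eq_cube power4_eq_xxxx)
  finally show ?thesis
    unfolding n_def d_def .
qed

end

theory Submission imports Defs "HOL-Real_Asymp.Real_Asymp" begin

text \<open>
  Conditionally on the weights \<open>s\<close>, the summands \<open>s\<^sub>i V\<^sub>i\<^sub>j\<close> are centred and uncorrelated, so the
  variance of their sum is the sum of the second moments of the \<open>s\<^sub>i\<close>.  For the linearised softmax,
  every numerator \<open>exp x\<^sub>i\<close> is lognormal with mean \<open>n = exp (1/2)\<close> and variance \<open>v = exp 2 - exp 1\<close>.
  The denominator has mean \<open>k n\<close> and variance \<open>k v\<close>, and its covariance with the numerator is \<open>v\<close>.
  Thus each entry has approximate mean \<open>1/k\<close> and approximate variance \<open>(v/n\<^sup>2) (1 - 1/k) / k\<^sup>2\<close>,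
  where \<open>v/n\<^sup>2 = exp 1 - 1\<close>, and summing over the \<open>k\<close> entries gives \<open>exp 1 / k\<close> to leading order.
\<close>

lemma integrable_mult_of_squares:
  fixes f g :: "'a \<Rightarrow> real"
  assumes [measurable]: "f \<in> borel_measurable M" "g \<in> borel_measurable M"
    and "integrable M (\<lambda>x. (f x)\<^sup>2)" "integrable M (\<lambda>x. (g x)\<^sup>2)"
  shows "integrable M (\<lambda>x. f x * g x)"
proof (rule Bochner_Integration.integrable_bound)
  show "integrable M (\<lambda>x. (f x)\<^sup>2 + (g x)\<^sup>2)"
    using assms by simp
  have "\<bar>a * b\<bar> \<le> a\<^sup>2 + b\<^sup>2" for a b :: real
    using sum_squares_bound[of "\<bar>a\<bar>" "\<bar>b\<bar>"] mult_nonneg_nonneg[of "\<bar>a\<bar>" "\<bar>b\<bar>"]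
    by (simp add: abs_mult del: mult_nonneg_nonneg)
  then show "AE x in M. norm (f x * g x) \<le> norm ((f x)\<^sup>2 + (g x)\<^sup>2)"
    by simp
qed measurable

context prob_space
begin

text \<open>The singletons \<open>{i}\<close> and \<open>{j}\<close> are disjoint blocks of indices;
  independence of the two restricted families passes to their only components by evaluation.\<close>

lemma indep_vars_imp_indep_var:
  assumes "indep_vars N X I" "i \<in> I" "j \<in> I" "i \<noteq> j"
  shows "indep_var (N i) (X i) (N j) (X j)"
proof -
  have "indep_var (N i) ((\<lambda>f. f i) \<circ> (\<lambda>\<omega>. \<lambda>l\<in>{i}. X l \<omega>)) (N j) ((\<lambda>f. f j) \<circ> (\<lambda>\<omega>. \<lambda>l\<in>{j}. X l \<omega>))"
    using assms by (intro indep_var_compose[OF indep_var_restrict[OF assms(1)]]) auto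
  then show ?thesis
    by (simp add: comp_def)
qed

text \<open>The weights may depend on each other, as softmax entries do through their common
  denominator, so independence is required between the two whole families. It splits the expectation
  of each product \<open>S i * S j * V i * V j\<close> in the expanded square, and the factor from
  \<open>V\<close> kills every term off the diagonal.\<close>

lemma variance_sum_random_weights:
  fixes S V :: "'i \<Rightarrow> 'a \<Rightarrow> real"
  assumes fin: "finite I"
    and ind: "indep_var (PiM I (\<lambda>_. borel)) (\<lambda>\<omega>. \<lambda>i\<in>I. S i \<omega>) (PiM I (\<lambda>_. borel)) (\<lambda>\<omega>. \<lambda>i\<in>I. V i \<omega>)"
    and S2: "\<And>i. i \<in> I \<Longrightarrow> integrable M (\<lambda>\<omega>. (S i \<omega>)\<^sup>2)"
    and V2: "\<And>i. i \<in> I \<Longrightarrow> integrable M (\<lambda>\<omega>. (V i \<omega>)\<^sup>2)"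
    and mean: "\<And>i. i \<in> I \<Longrightarrow> expectation (V i) = 0"
    and uncorrelated: "\<And>i j. i \<in> I \<Longrightarrow> j \<in> I \<Longrightarrow> i \<noteq> j \<Longrightarrow> expectation (\<lambda>\<omega>. V i \<omega> * V j \<omega>) = 0"
  shows "variance (\<lambda>\<omega>. \<Sum>i\<in>I. S i \<omega> * V i \<omega>)
    = (\<Sum>i\<in>I. expectation (\<lambda>\<omega>. (S i \<omega>)\<^sup>2) * variance (V i))"
proof -
  have ind_comp: "indep_var borel (\<lambda>\<omega>. F (\<lambda>i\<in>I. S i \<omega>)) borel (\<lambda>\<omega>. G (\<lambda>i\<in>I. V i \<omega>))"
    if "F \<in> borel_measurable (PiM I (\<lambda>_. borel))" "G \<in> borel_measurable (PiM I (\<lambda>_. borel))"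
    for F G :: "('i \<Rightarrow> real) \<Rightarrow> real"
    using indep_var_compose[OF ind that] by (simp add: comp_def)
  have ind1: "indep_var borel (S i) borel (V i)" if "i \<in> I" for i
    using ind_comp[of "\<lambda>f. f i" "\<lambda>f. f i"] that by simp
  have ind2: "indep_var borel (\<lambda>\<omega>. S i \<omega> * S j \<omega>) borel (\<lambda>\<omega>. V i \<omega> * V j \<omega>)"
    if "i \<in> I" "j \<in> I" for i j
    using ind_comp[of "\<lambda>f. f i * f j" "\<lambda>f. f i * f j"] that by simp
  have meas: "S i \<in> borel_measurable M" "V i \<in> borel_measurable M" if "i \<in> I" for i
    using ind1[OF that] by (auto dest: indep_var_rv1 indep_var_rv2)
  have int1: "integrable M (S i)" "integrable M (V i)" if "i \<in> I" for i
    using that meas S2 V2 by (auto intro: square_integrable_imp_integrable)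
  have int2: "integrable M (\<lambda>\<omega>. S i \<omega> * S j \<omega>)" "integrable M (\<lambda>\<omega>. V i \<omega> * V j \<omega>)"
    if "i \<in> I" "j \<in> I" for i j
    using that meas S2 V2 by (auto intro: integrable_mult_of_squares)
  let ?W = "\<lambda>\<omega>. \<Sum>i\<in>I. S i \<omega> * V i \<omega>"
  have "expectation ?W = (\<Sum>i\<in>I. expectation (S i) * expectation (V i))"
    using indep_var_lebesgue_integral[OF ind1 int1] indep_var_integrable[OF ind1 int1]
    by (subst Bochner_Integration.integral_sum) auto
  then have "expectation ?W = 0"
    using mean by simp
  then have "variance ?W = expectation (\<lambda>\<omega>. (?W \<omega>)\<^sup>2)"
    by (rule variance_mean_zero)
  also have "\<dots> = expectation (\<lambda>\<omega>. \<Sum>i\<in>I. \<Sum>j\<in>I. (S i \<omega> * S j \<omega>) * (V i \<omega> * V j \<omega>))"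
    by (simp add: power2_eq_square sum_product mult_ac)
  also have "\<dots> = (\<Sum>i\<in>I. \<Sum>j\<in>I. expectation (\<lambda>\<omega>. S i \<omega> * S j \<omega>) * expectation (\<lambda>\<omega>. V i \<omega> * V j \<omega>))"
    using indep_var_lebesgue_integral[OF ind2 int2] indep_var_integrable[OF ind2 int2]
    by (simp add: Bochner_Integration.integral_sum Bochner_Integration.integrable_sum)
  also have "\<dots> = (\<Sum>i\<in>I. \<Sum>j\<in>I.
      if i = j then expectation (\<lambda>\<omega>. S i \<omega> * S i \<omega>) * expectation (\<lambda>\<omega>. V i \<omega> * V i \<omega>) else 0)"
    using uncorrelated by (intro sum.cong) auto
  \<comment> \<open>Since \<open>V i\<close> is centred, its second moment is its variance.\<close>
  also have "\<dots> = (\<Sum>i\<in>I. expectation (\<lambda>\<omega>. (S i \<omega>)\<^sup>2) * variance (V i))"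
    using fin mean by (simp add: power2_eq_square)
  finally show ?thesis .
qed

text \<open>Pairwise independence makes the covariance matrix of the \<open>Y j\<close> equal to
  \<open>v\<close> times the identity. The covariance of numerator and denominator is then the sum
  of one row, and the variance of the denominator the sum of all entries.\<close>

lemma
  fixes Y :: "nat \<Rightarrow> 'a \<Rightarrow> real"
  assumes ind: "\<And>j l. j < k \<Longrightarrow> l < k \<Longrightarrow> j \<noteq> l \<Longrightarrow> indep_var borel (Y j) borel (Y l)"
    and i: "i < k"
    and Y2: "\<And>j. j < k \<Longrightarrow> integrable M (\<lambda>\<omega>. (Y j \<omega>)\<^sup>2)"
    and mean: "\<And>j. j < k \<Longrightarrow> expectation (Y j) = n" and n: "n \<noteq> 0"
    and var: "\<And>j. j < k \<Longrightarrow> variance (Y j) = v"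
  shows ratio_mean1_summand: "ratio_mean1 M (Y i) (\<lambda>\<omega>. \<Sum>j<k. Y j \<omega>) = 1 / k"
    and ratio_var1_summand: "ratio_var1 M (Y i) (\<lambda>\<omega>. \<Sum>j<k. Y j \<omega>) = v / n\<^sup>2 * (1 - 1 / k) / (real k)\<^sup>2"
proof -
  let ?D = "\<lambda>\<omega>. \<Sum>j<k. Y j \<omega>"
  define Z where "Z = (\<lambda>j \<omega>. Y j \<omega> - n)"
  \<comment> \<open>The mean \<open>n\<close> is nonzero, whereas a non-integrable function has
    integral 0 by convention.\<close>
  have int: "integrable M (Y j)" if "j < k" for j
    using mean[OF that] n by (metis not_integrable_integral_eq)
  have k: "real k \<noteq> 0"
    using i by simp
  have D: "expectation ?D = k * n"
    using int mean by (subst Bochner_Integration.integral_sum) auto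
  have intYY: "integrable M (\<lambda>\<omega>. Y j \<omega> * Y l \<omega>)" if "j < k" "l < k" for j l
    using that int Y2 by (auto intro!: integrable_mult_of_squares borel_measurable_integrable)
  have D2: "integrable M (\<lambda>\<omega>. (?D \<omega>)\<^sup>2)"
    unfolding power2_eq_square sum_product
    using intYY by (intro Bochner_Integration.integrable_sum) simp
  have cov: "expectation (\<lambda>\<omega>. Z j \<omega> * Z l \<omega>) = (if j = l then v else 0)" if "j < k" "l < k" for j l
  proof (cases "j = l")
    case True
    then show ?thesis
      using var mean that by (simp add: Z_def power2_eq_square)
  next
    case False
    have "indep_var borel ((\<lambda>y. y - n) \<circ> Y j) borel ((\<lambda>y. y - n) \<circ> Y l)"
      using that False by (intro indep_var_compose[OF ind]) auto
    then have "indep_var borel (Z j) borel (Z l)"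
      by (simp add: Z_def comp_def)
    then show ?thesis
      using False that int mean by (subst indep_var_lebesgue_integral) (auto simp: Z_def prob_space)
  qed
  have intZ: "integrable M (\<lambda>\<omega>. Z j \<omega> * Z l \<omega>)" if "j < k" "l < k" for j l
    using that int intYY by (simp add: Z_def algebra_simps)
  have DZ: "?D \<omega> - k * n = (\<Sum>j<k. Z j \<omega>)" for \<omega>
    by (simp add: Z_def sum_subtractf)
  have covND: "expectation (\<lambda>\<omega>. (Y i \<omega> - n) * (?D \<omega> - k * n)) = v"
  proof -
    have "expectation (\<lambda>\<omega>. (Y i \<omega> - n) * (?D \<omega> - k * n)) = expectation (\<lambda>\<omega>. \<Sum>j<k. Z i \<omega> * Z j \<omega>)"
      unfolding DZ by (simp add: Z_def sum_distrib_left)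
    also have "\<dots> = (\<Sum>j<k. if i = j then v else 0)"
      using i cov intZ by (simp add: Bochner_Integration.integral_sum)
    finally show ?thesis
      using i by simp
  qed
  have varD: "variance ?D = k * v"
  proof -
    have "variance ?D = expectation (\<lambda>\<omega>. \<Sum>j<k. \<Sum>l<k. Z j \<omega> * Z l \<omega>)"
      unfolding D DZ by (simp add: power2_eq_square sum_product)
    also have "\<dots> = (\<Sum>j<k. \<Sum>l<k. if j = l then v else 0)"
      using cov intZ
      by (subst Bochner_Integration.integral_sum)
        (auto simp: Bochner_Integration.integral_sum intro!: Bochner_Integration.integrable_sum)
    finally show ?thesis
      by simp
  qed
  have intD: "integrable M ?D"
    using int by (intro Bochner_Integration.integrable_sum) simp
  show "ratio_mean1 M (Y i) ?D = 1 / k"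
    using ratio_mean1_eq[OF prob_space_axioms int[OF i] intD] i mean n k D by simp
  have "ratio_var1 M (Y i) ?D = n\<^sup>2 / (k * n)\<^sup>2 * (v / n\<^sup>2 - 2 * v / (n * (k * n)) + k * v / (k * n)\<^sup>2)"
    using ratio_var1_eq[OF prob_space_axioms int[OF i] intD Y2[OF i] D2] n k
    unfolding D mean[OF i] covND varD[unfolded D] var[OF i, unfolded mean[OF i]] by simp
  \<comment> \<open>Relative to the numerator's own term, the covariance contributes
    \<open>-2 / k\<close> and the variance of the denominator \<open>1 / k\<close>, together
    \<open>-1 / k\<close>.\<close>
  then show "ratio_var1 M (Y i) ?D = v / n\<^sup>2 * (1 - 1 / k) / (real k)\<^sup>2"
    using n k by (simp add: divide_simps power2_eq_square) (simp add: algebra_simps)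
qed

end

text \<open>Completing the square: tilting the standard normal density by \<open>exp (t * z)\<close>
  shifts its mean to \<open>t\<close> and leaves the factor \<open>exp (t\<^sup>2 / 2)\<close>. The
  cases \<open>t = 1\<close> and \<open>t = 2\<close> yield the first two moments of the lognormal
  \<open>exp (X \<omega>)\<close>.\<close>

lemma
  assumes X: "distributed M lborel X (normal_density 0 1)"
  shows integrable_exp_std_normal: "integrable M (\<lambda>\<omega>. exp (t * X \<omega>))"
    and expectation_exp_std_normal: "(\<integral>\<omega>. exp (t * X \<omega>) \<partial>M) = exp (t\<^sup>2 / 2)"
proof -
  have eq: "normal_density 0 1 z * exp (t * z) = exp (t\<^sup>2 / 2) * normal_density t 1 z" for z
    by (simp add: normal_density_def mult_exp_exp power2_diff field_simps)
  show "integrable M (\<lambda>\<omega>. exp (t * X \<omega>))"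
    by (subst distributed_integrable[OF X, symmetric]) (auto simp: eq)
  show "(\<integral>\<omega>. exp (t * X \<omega>) \<partial>M) = exp (t\<^sup>2 / 2)"
    by (subst distributed_integral[OF X, symmetric]) (auto simp: eq)
qed

lemma softmax_nonneg: "0 \<le> softmax k x i"
  by (simp add: softmax_def sum_nonneg)

lemma softmax_le_1: "i < k \<Longrightarrow> softmax k x i \<le> 1"
  unfolding softmax_def
  by (rule divide_le_eq_1_pos[THEN iffD2]) (auto intro!: sum_pos member_le_sum)

text \<open>The linearisation enters only the second conjunct. The first is exact for the true
  softmax moments and justifies inserting approximate moments into
  \<open>var_of_moments\<close>.\<close>

theorem proposition2p1:
  fixes M :: "nat \<Rightarrow> 'a measure"
    and x :: "nat \<Rightarrow> nat \<Rightarrow> 'a \<Rightarrow> real"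
    and V :: "nat \<Rightarrow> nat \<Rightarrow> nat \<Rightarrow> 'a \<Rightarrow> real"
    and s a :: "nat \<Rightarrow> nat \<Rightarrow> 'a \<Rightarrow> real"
    and m :: nat
  assumes s: "\<And>k i \<omega>. s k i \<omega> = softmax k (\<lambda>l. x k l \<omega>) i"
    and a: "\<And>k j \<omega>. a k j \<omega> = vec_mat_mult k (\<lambda>i. s k i \<omega>) (\<lambda>i l. V k i l \<omega>) j"
    and prob: "\<And>k. k \<ge> 1 \<Longrightarrow> prob_space (M k)"
    and indep: "\<And>k. k \<ge> 1 \<Longrightarrow> prob_space.indep_vars (M k) (\<lambda>_. borel)
          (case_sum (x k) (\<lambda>(i, j). V k i j)) ({..<k} <+> ({..<k} \<times> {..<m}))"
    and x_normal: "\<And>k i. i < k \<Longrightarrow> distributed (M k) lborel (x k i) (normal_density 0 1)"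
    and V_integrable: "\<And>k i j. i < k \<Longrightarrow> j < m \<Longrightarrow> integrable (M k) (V k i j)"
    and V_mean: "\<And>k i j. i < k \<Longrightarrow> j < m \<Longrightarrow> prob_space.expectation (M k) (V k i j) = 0"
    and V_var: "\<And>k i j. i < k \<Longrightarrow> j < m \<Longrightarrow> prob_space.variance (M k) (V k i j) = 1"
  shows "(\<forall>k\<ge>1. \<forall>j<m. prob_space.variance (M k) (a k j) =
            var_of_moments k (\<lambda>i. prob_space.expectation (M k) (s k i))
                             (\<lambda>i. prob_space.variance (M k) (s k i))) \<and>
         (\<exists>c>0. (\<lambda>k. var_of_moments k (softmax_mean1 (M k) k (x k)) (softmax_var1 (M k) k (x k)))
                  \<sim>[at_top] (\<lambda>k. c / real k))"
proof (intro conjI allI impI)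
  fix k j :: nat
  assume k: "k \<ge> 1" and j: "j < m"
  interpret prob_space "M k"
    using k by (rule prob)
  let ?F = "case_sum (x k) (\<lambda>(i, j). V k i j)"
  let ?A = "Inl ` {..<k} :: (nat + nat \<times> nat) set"
  let ?B = "Inr ` ({..<k} \<times> {j}) :: (nat + nat \<times> nat) set"
  have x_meas [measurable]: "x k i \<in> borel_measurable (M k)" if "i < k" for i
    using x_normal[OF that] by (simp add: distributed_def)
  have s_meas: "s k i \<in> borel_measurable (M k)" if "i < k" for i
    using that unfolding s softmax_def by measurable
  \<comment> \<open>On a probability space these bounds already make the softmax entries and their
    squares integrable.\<close>
  have s_bounds: "0 \<le> s k i \<omega>" "i < k \<Longrightarrow> s k i \<omega> \<le> 1" for i \<omega>
    unfolding s by (simp_all add: softmax_nonneg softmax_le_1)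
  have s_int: "integrable (M k) (s k i)" if "i < k" for i
    using that s_bounds s_meas by (intro integrable_const_bound[where B = 1]) auto
  have s2_int: "integrable (M k) (\<lambda>\<omega>. (s k i \<omega>)\<^sup>2)" if "i < k" for i
    using that s_bounds s_meas by (intro integrable_const_bound[where B = 1]) (auto simp: power_le_one)
  \<comment> \<open>A non-integrable square would have integral 0 by convention, contradicting unit variance.\<close>
  have V_int2: "integrable (M k) (\<lambda>\<omega>. (V k i j \<omega>)\<^sup>2)" if "i < k" for i
  proof (rule ccontr)
    assume "\<not> ?thesis"
    then have "expectation (\<lambda>\<omega>. (V k i j \<omega>)\<^sup>2) = 0"
      by (rule not_integrable_integral_eq)
    then show False
      using V_var[OF that j] V_mean[OF that j] by simp
  qed
  \<comment> \<open>\<open>?A\<close> holds all indices of \<open>x\<close>, and \<open>?B\<close>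
    those of column \<open>j\<close> of \<open>V\<close>. The blocks are disjoint, so functions of
    them are independent; those composed below are the softmax vector and the column itself.\<close>
  have "indep_var (PiM ?A (\<lambda>_. borel)) (\<lambda>\<omega>. \<lambda>l\<in>?A. ?F l \<omega>) (PiM ?B (\<lambda>_. borel)) (\<lambda>\<omega>. \<lambda>l\<in>?B. ?F l \<omega>)"
    using j by (intro indep_var_restrict[OF indep[OF k]]) auto
  then have "indep_var
      (PiM {..<k} (\<lambda>_. borel)) ((\<lambda>f. \<lambda>i\<in>{..<k}. softmax k (\<lambda>l. f (Inl l)) i) \<circ> (\<lambda>\<omega>. \<lambda>l\<in>?A. ?F l \<omega>))
      (PiM {..<k} (\<lambda>_. borel)) ((\<lambda>f. \<lambda>i\<in>{..<k}. f (Inr (i, j))) \<circ> (\<lambda>\<omega>. \<lambda>l\<in>?B. ?F l \<omega>))"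
  proof (rule indep_var_compose)
    have [measurable]: "(\<lambda>f. f (Inl l)) \<in> borel_measurable (PiM ?A (\<lambda>_. borel))" if "l < k" for l
      using that by (intro measurable_component_singleton) auto
    show "(\<lambda>f. \<lambda>i\<in>{..<k}. softmax k (\<lambda>l. f (Inl l)) i) \<in> PiM ?A (\<lambda>_. borel) \<rightarrow>\<^sub>M PiM {..<k} (\<lambda>_. borel)"
      unfolding softmax_def by (intro measurable_restrict) measurable
    show "(\<lambda>f. \<lambda>i\<in>{..<k}. f (Inr (i, j))) \<in> PiM ?B (\<lambda>_. borel) \<rightarrow>\<^sub>M PiM {..<k} (\<lambda>_. borel)"
      by (intro measurable_restrict measurable_component_singleton) auto
  qed
  \<comment> \<open>Restricting to \<open>?A\<close> changes nothing here, because
    \<open>softmax k\<close> reads only entries with index below \<open>k\<close>.\<close>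
  also have "(\<lambda>f. \<lambda>i\<in>{..<k}. softmax k (\<lambda>l. f (Inl l)) i) \<circ> (\<lambda>\<omega>. \<lambda>l\<in>?A. ?F l \<omega>)
      = (\<lambda>\<omega>. \<lambda>i\<in>{..<k}. s k i \<omega>)"
    by (auto simp: fun_eq_iff s softmax_def intro!: arg_cong2[where f = "(/)"] sum.cong)
  also have "(\<lambda>f. \<lambda>i\<in>{..<k}. f (Inr (i, j))) \<circ> (\<lambda>\<omega>. \<lambda>l\<in>?B. ?F l \<omega>) = (\<lambda>\<omega>. \<lambda>i\<in>{..<k}. V k i j \<omega>)"
    by (auto simp: fun_eq_iff)
  finally have ind_sV: "indep_var (PiM {..<k} (\<lambda>_. borel)) (\<lambda>\<omega>. \<lambda>i\<in>{..<k}. s k i \<omega>)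
    (PiM {..<k} (\<lambda>_. borel)) (\<lambda>\<omega>. \<lambda>i\<in>{..<k}. V k i j \<omega>)" .
  have uncorrelated: "expectation (\<lambda>\<omega>. V k i j \<omega> * V k l j \<omega>) = 0" if "i < k" "l < k" "i \<noteq> l" for i l
  proof -
    have "indep_var borel (V k i j) borel (V k l j)"
      using indep_vars_imp_indep_var[OF indep[OF k], of "Inr (i, j)" "Inr (l, j)"] that j by auto
    then show ?thesis
      using that j V_integrable V_mean by (subst indep_var_lebesgue_integral) auto
  qed
  have "a k j = (\<lambda>\<omega>. \<Sum>i<k. s k i \<omega> * V k i j \<omega>)"
    by (simp add: fun_eq_iff a vec_mat_mult_def)
  then have "variance (a k j) = (\<Sum>i<k. expectation (\<lambda>\<omega>. (s k i \<omega>)\<^sup>2) * variance (V k i j))"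
    using variance_sum_random_weights[OF _ ind_sV] s2_int V_int2 V_mean[OF _ j] uncorrelated by simp
  \<comment> \<open>Unit variances leave the second moments of the weights, each a variance plus a
    squared mean.\<close>
  also have "\<dots> = (\<Sum>i<k. variance (s k i) + (expectation (s k i))\<^sup>2)"
    using V_var[OF _ j] variance_eq[OF s_int s2_int] by (intro sum.cong) auto
  finally show "variance (a k j) =
      var_of_moments k (\<lambda>i. expectation (s k i)) (\<lambda>i. variance (s k i))"
    by (simp add: var_of_moments_def)
next
  \<comment> \<open>The Taylor expression has a closed form for every positive \<open>k\<close>; the
    limit is taken only afterwards. The lognormal variables \<open>exp (x k i \<omega>)\<close> take
    the place of the \<open>Y j\<close>.\<close>
  have formula: "var_of_moments k (softmax_mean1 (M k) k (x k)) (softmax_var1 (M k) k (x k))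
      = ((exp 1 - 1) * (1 - 1 / k) + 1) / k" if k: "k \<ge> 1" for k
  proof -
    interpret prob_space "M k"
      using k by (rule prob)
    have ind: "indep_var borel (\<lambda>\<omega>. exp (x k i \<omega>)) borel (\<lambda>\<omega>. exp (x k j \<omega>))"
      if "i < k" "j < k" "i \<noteq> j" for i j
    proof -
      have "indep_var borel (x k i) borel (x k j)"
        using indep_vars_imp_indep_var[OF indep[OF k], of "Inl i" "Inl j"] that by auto
      then have "indep_var borel (exp \<circ> x k i) borel (exp \<circ> x k j)"
        by (rule indep_var_compose) simp_all
      then show ?thesis
        by (simp add: comp_def)
    qed
    have int: "integrable (M k) (\<lambda>\<omega>. exp (x k i \<omega>))"
      and int2: "integrable (M k) (\<lambda>\<omega>. (exp (x k i \<omega>))\<^sup>2)"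
      and mean: "expectation (\<lambda>\<omega>. exp (x k i \<omega>)) = exp (1 / 2)"
      and mean2: "expectation (\<lambda>\<omega>. (exp (x k i \<omega>))\<^sup>2) = exp 2" if "i < k" for i
      using integrable_exp_std_normal[OF x_normal[OF that], of 1]
        integrable_exp_std_normal[OF x_normal[OF that], of 2]
        expectation_exp_std_normal[OF x_normal[OF that], of 1]
        expectation_exp_std_normal[OF x_normal[OF that], of 2]
      by (simp_all add: exp_double)
    have half: "(exp (1 / 2))\<^sup>2 = exp (1 :: real)"
      by (simp flip: exp_double)
    have var: "variance (\<lambda>\<omega>. exp (x k i \<omega>)) = exp 2 - exp 1" if "i < k" for i
      using that by (subst variance_eq) (simp_all add: int int2 mean mean2 half)
    have exp2: "exp 2 = exp 1 * exp (1 :: real)"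
      by (simp flip: exp_add)
    have "softmax_mean1 (M k) k (x k) i = 1 / k"
      and "softmax_var1 (M k) k (x k) i = (exp 1 - 1) * (1 - 1 / k) / (real k)\<^sup>2" if "i < k" for i
      unfolding softmax_mean1_def softmax_var1_def
      using ratio_mean1_summand[OF ind that int2 mean _ var] ratio_var1_summand[OF ind that int2 mean _ var]
      by (simp_all add: half exp2 diff_divide_distrib)
    then have "var_of_moments k (softmax_mean1 (M k) k (x k)) (softmax_var1 (M k) k (x k))
        = (\<Sum>i<k. (exp 1 - 1) * (1 - 1 / k) / (real k)\<^sup>2 + (1 / k)\<^sup>2)"
      by (simp add: var_of_moments_def)
    \<comment> \<open>All \<open>k\<close> summands are equal, so one factor \<open>1 / k\<close>
      cancels.\<close>
    also have "\<dots> = ((exp 1 - 1) * (1 - 1 / k) + 1) / k"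
      using k by (simp add: power_divide power2_eq_square flip: add_divide_distrib)
    finally show ?thesis .
  qed
  \<comment> \<open>Variances and squared means contribute at the same order: the former give
    \<open>exp 1 - 1\<close> in the limit, the latter 1. Their sum is the constant
    \<open>exp 1\<close>.\<close>
  have "(\<lambda>k. ((exp 1 - 1) * (1 - 1 / real k) + 1) / real k) \<sim>[at_top] (\<lambda>k. exp 1 / real k)"
    by real_asymp
  also have "?this \<longleftrightarrow> (\<lambda>k. var_of_moments k (softmax_mean1 (M k) k (x k)) (softmax_var1 (M k) k (x k)))
      \<sim>[at_top] (\<lambda>k. exp 1 / real k)"
    \<comment> \<open>The closed form is established for \<open>k\<close> at least 1, and asymptotic
      equivalence ignores the remaining case \<open>k = 0\<close>.\<close>
    by (intro asymp_equiv_cong eventually_mono[OF eventually_ge_at_top[of 1]]) (simp_all add: formula)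
  finally have "(\<lambda>k. var_of_moments k (softmax_mean1 (M k) k (x k)) (softmax_var1 (M k) k (x k)))
      \<sim>[at_top] (\<lambda>k. exp 1 / real k)" .
  then show "\<exists>c>0. (\<lambda>k. var_of_moments k (softmax_mean1 (M k) k (x k)) (softmax_var1 (M k) k (x k)))
      \<sim>[at_top] (\<lambda>k. c / real k)"
    by (intro exI[of _ "exp 1"]) simp
qed

end
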